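(* Let $(\Omega,\sigma)$ be a minimal continuous flow on a compact metric space, let $a,b:\Omega\to\mathbb{R}$ be continuous, and let $g:\Omega\times\mathbb{R}\to\mathbb{R}$ satisfy: - the partial derivative $g_x$ exists, and $g,g_x$ are continuous on $\Omega\times\mathbb{R}$; - there exist real numbers $r_1\le r_2$ such that $g(\omega,x)=0$ if $r_1\le x\le r_2$, $g(\omega,x)>0$ if $x<r_1$, $g(\omega,x)<0$ if $x>r_2$, and, in case $r_1=r_2$, $g_x(\omega,r_1)=0$ for all $\omega\in\Omega$; - $\lim_{x\to\pm\infty}g(\omega,x)/x=-\infty$ uniformly on $\Omega$; - $g_x(\omega,x)\le0$ whenever $x\notin[r_1,r_2]$. Let $(\Omega\times\mathbb{R},\tau)$ be the flow induced by the family $x'=a(\omega\cdot t)\,x+b(\omega\cdot t)+g(\omega\cdot t,x)$, $\omega\in\Omega$, and let $\mathcal{A}$ be its global attractor. Assume also that $\sup\Sigma_a<0$. Then $\mathcal{A}$ is a uniformly exponentially stable at $+\infty$ copy of the base which attracts exponentially any $\tau$-orbit as time increases. In particular, $\mathcal{A}$ is the unique $\tau$-minimal set.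
   Context: Write $\omega\cdot t:=\sigma(t,\omega)$. The induced (local) flow is $\tau(t,\omega,x_0)=(\omega\cdot t,x(t,\omega,x_0))$, where $x(t,\omega,x_0)$ is the maximal solution of the equation corresponding to $\omega$ with $x(0,\omega,x_0)=x_0$. A set is $\tau$-invariant if it is composed of globally defined orbits and is mapped onto itself by $\tau_t$ for all $t\in\mathbb{R}$. A $\tau$-minimal set is a nonempty compact $\tau$-invariant set with no proper nonempty compact $\tau$-invariant subset ($(\Omega,\sigma)$ minimal: $\Omega$ itself is minimal for $\sigma$). Sacker–Sell spectrum: the family $x'=c(\omega\cdot t)\,x$, $\omega\in\Omega$ ($c$ continuous) has exponential dichotomy over $\Omega$ if there are $\kappa\ge1$, $\gamma>0$ such that either $\exp\int_0^t c(\omega\cdot l)\,dl\le\kappa e^{-\gamma t}$ for all $\omega\in\Omega$, $t\ge0$, or $\exp\int_0^t c(\omega\cdot l)\,dl\le\kappa e^{\gamma t}$ for all $\omega\in\Omega$, $t\le0$. $\Sigma_a$ is the set of $\lambda\in\mathbb{R}$ such that $x'=(a(\omega\cdot t)-\lambda)\,x$, $\omega\in\Omega$, does not have exponential dichotomy over $\Omega$. (It is known that $\Sigma_a$ is the compact interval with endpoints the infimum and supremum of $\int_\Omega a\,dm$ over the $\sigma$-invariant Borel probability measures $m$, both attained at ergodic measures.) Background: under the stated conditions all forward semiorbits are globally defined and bounded, and $\tau$ has a global attractor $\mathcal{A}$, i.e. a compact $\tau$-invariant set with $\lim_{t\to\infty}\mathrm{dist}(\tau_t(\mathcal{C}),\mathcal{A})=0$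 (Hausdorff semidistance) for every bounded $\mathcal{C}\subset\Omega\times\mathbb{R}$. A set is a copy of the base if it is the graph of a continuous $\eta:\Omega\to\mathbb{R}$ with $\eta(\omega\cdot t)=x(t,\omega,\eta(\omega))$ for all $t,\omega$. A compact $\tau$-invariant set $\mathcal{K}$ is uniformly exponentially stable at $+\infty$ (on the fiber) if there are $\delta>0$, $\kappa\ge1$, $\gamma>0$ such that, if $(\omega,\bar x_0)\in\mathcal{K}$ and $|\bar x_0-x_0|<\delta$, then $x(t,\omega,x_0)$ is defined for all $t\ge0$ and $|x(t,\omega,\bar x_0)-x(t,\omega,x_0)|\le\kappa e^{-\gamma t}|\bar x_0-x_0|$ for $t\ge0$. A copy of the base with graph function $\eta$ attracts exponentially any $\tau$-orbit as time increases if for every $(\omega,x_0)$ there are $C,\gamma>0$ with $|x(t,\omega,x_0)-\eta(\omega\cdot t)|\le Ce^{-\gamma t}$ for all $t\ge0$. *)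

theory Defs
  imports "HOL-Analysis.Analysis"
begin

section \<open>Flows on the base\<close>

definition continuous_flow :: "(real \<Rightarrow> 'w::topological_space \<Rightarrow> 'w) \<Rightarrow> bool" where
  "continuous_flow \<sigma> \<longleftrightarrow>
     continuous_on UNIV (\<lambda>(t, \<omega>). \<sigma> t \<omega>) \<and>
     (\<forall>\<omega>. \<sigma> 0 \<omega> = \<omega>) \<and>
     (\<forall>s t \<omega>. \<sigma> (s + t) \<omega> = \<sigma> s (\<sigma> t \<omega>))"

definition flow_invariant :: "(real \<Rightarrow> 'w \<Rightarrow> 'w) \<Rightarrow> 'w set \<Rightarrow> bool" where
  "flow_invariant \<sigma> S \<longleftrightarrow> (\<forall>t. \<sigma> t ` S = S)"

text \<open>Minimality with respect to a notion of invariance \<open>inv_set\<close>; it is used both for the base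
  flow and for the local flow on the bundle.\<close>

definition minimal_set :: "('p::topological_space set \<Rightarrow> bool) \<Rightarrow> 'p set \<Rightarrow> bool" where
  "minimal_set inv_set M \<longleftrightarrow>
     M \<noteq> {} \<and> compact M \<and> inv_set M \<and>
     (\<forall>N. N \<noteq> {} \<and> compact N \<and> inv_set N \<and> N \<subseteq> M \<longrightarrow> N = M)"

section \<open>Sacker--Sell spectrum of a scalar linear family\<close>

text \<open>The integral \<open>LBINT l=0..t\<close> is oriented, so it changes sign for \<open>t < 0\<close>.\<close>

definition exp_dichotomy :: "(real \<Rightarrow> 'w \<Rightarrow> 'w) \<Rightarrow> ('w \<Rightarrow> real) \<Rightarrow> bool" where
  "exp_dichotomy \<sigma> c \<longleftrightarrow>
     (\<exists>\<kappa>\<ge>1. \<exists>\<gamma>>0.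
        (\<forall>\<omega>. \<forall>t\<ge>0. exp (LBINT l=ereal 0..ereal t. c (\<sigma> l \<omega>)) \<le> \<kappa> * exp (- \<gamma> * t)) \<or>
        (\<forall>\<omega>. \<forall>t\<le>0. exp (LBINT l=ereal 0..ereal t. c (\<sigma> l \<omega>)) \<le> \<kappa> * exp (\<gamma> * t)))"

definition sacker_sell_spectrum :: "(real \<Rightarrow> 'w \<Rightarrow> 'w) \<Rightarrow> ('w \<Rightarrow> real) \<Rightarrow> real set" where
  "sacker_sell_spectrum \<sigma> a = {s. \<not> exp_dichotomy \<sigma> (\<lambda>\<omega>. a \<omega> - s)}"

section \<open>The local flow induced by a family of scalar equations\<close>

text \<open>Throughout, \<open>f\<close> stands for the family \<open>x' = f (\<sigma> t \<omega>) x\<close>.\<close>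

definition solves_on ::
  "(real \<Rightarrow> 'w \<Rightarrow> 'w) \<Rightarrow> ('w \<Rightarrow> real \<Rightarrow> real) \<Rightarrow> 'w \<Rightarrow> real \<Rightarrow> real set \<Rightarrow> (real \<Rightarrow> real) \<Rightarrow> bool" where
  "solves_on \<sigma> f \<omega> x0 I u \<longleftrightarrow>
     open I \<and> is_interval I \<and> 0 \<in> I \<and> u 0 = x0 \<and>
     (\<forall>t\<in>I. (u has_real_derivative f (\<sigma> t \<omega>) (u t)) (at t))"

text \<open>The maximal solution is glued from all solutions on open intervals around \<open>0\<close>. This relies on
  uniqueness of solutions, which holds when \<open>f\<close> is continuously differentiable in the state
  variable. The value \<open>max_sol\<close> is meaningful only at times in \<open>max_dom\<close>.\<close>

definition max_dom ::
  "(real \<Rightarrow> 'w \<Rightarrow> 'w) \<Rightarrow> ('w \<Rightarrow> real \<Rightarrow> real) \<Rightarrow> 'w \<Rightarrow> real \<Rightarrow> real set" where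
  "max_dom \<sigma> f \<omega> x0 = \<Union>{I. \<exists>u. solves_on \<sigma> f \<omega> x0 I u}"

definition max_sol ::
  "(real \<Rightarrow> 'w \<Rightarrow> 'w) \<Rightarrow> ('w \<Rightarrow> real \<Rightarrow> real) \<Rightarrow> real \<Rightarrow> 'w \<Rightarrow> real \<Rightarrow> real" where
  "max_sol \<sigma> f t \<omega> x0 = (THE y. \<exists>I u. solves_on \<sigma> f \<omega> x0 I u \<and> t \<in> I \<and> u t = y)"

text \<open>The image of a set under the partial map \<open>\<tau>\<^sub>t\<close>: only points whose orbit is defined at
  time \<open>t\<close> contribute.\<close>

definition tau_image ::
  "(real \<Rightarrow> 'w \<Rightarrow> 'w) \<Rightarrow> ('w \<Rightarrow> real \<Rightarrow> real) \<Rightarrow> real \<Rightarrow> ('w \<times> real) set \<Rightarrow> ('w \<times> real) set" where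
  "tau_image \<sigma> f t S =
     {(\<sigma> t \<omega>, max_sol \<sigma> f t \<omega> x0) | \<omega> x0. (\<omega>, x0) \<in> S \<and> t \<in> max_dom \<sigma> f \<omega> x0}"

definition tau_invariant ::
  "(real \<Rightarrow> 'w \<Rightarrow> 'w) \<Rightarrow> ('w \<Rightarrow> real \<Rightarrow> real) \<Rightarrow> ('w \<times> real) set \<Rightarrow> bool" where
  "tau_invariant \<sigma> f S \<longleftrightarrow>
     (\<forall>(\<omega>, x0)\<in>S. max_dom \<sigma> f \<omega> x0 = UNIV) \<and> (\<forall>t. tau_image \<sigma> f t S = S)"

section \<open>Global attractor, copies of the base, stability\<close>

text \<open>With values in \<^typ>\<open>ennreal\<close> no boundedness or nonemptiness is needed: the semidistance
  from a nonempty set to \<open>{}\<close> is \<open>\<infinity>\<close>.\<close>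

definition hausdorff_semidist :: "'p::metric_space set \<Rightarrow> 'p set \<Rightarrow> ennreal" where
  "hausdorff_semidist C D = (SUP p\<in>C. INF q\<in>D. ennreal (dist p q))"

definition global_attractor ::
  "(real \<Rightarrow> 'w::metric_space \<Rightarrow> 'w) \<Rightarrow> ('w \<Rightarrow> real \<Rightarrow> real) \<Rightarrow> ('w \<times> real) set \<Rightarrow> bool" where
  "global_attractor \<sigma> f A \<longleftrightarrow>
     compact A \<and> tau_invariant \<sigma> f A \<and>
     (\<forall>C. bounded C \<longrightarrow> ((\<lambda>t. hausdorff_semidist (tau_image \<sigma> f t C) A) \<longlongrightarrow> 0) at_top)"

definition base_graph :: "('w \<Rightarrow> real) \<Rightarrow> ('w \<times> real) set" where
  "base_graph \<eta> = range (\<lambda>\<omega>. (\<omega>, \<eta> \<omega>))"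

text \<open>\<open>\<eta>\<close> is the graph function of a copy of the base; the copy itself is \<open>base_graph \<eta>\<close>.\<close>

definition copy_of_base_fun ::
  "(real \<Rightarrow> 'w::topological_space \<Rightarrow> 'w) \<Rightarrow> ('w \<Rightarrow> real \<Rightarrow> real) \<Rightarrow> ('w \<Rightarrow> real) \<Rightarrow> bool" where
  "copy_of_base_fun \<sigma> f \<eta> \<longleftrightarrow>
     continuous_on UNIV \<eta> \<and>
     (\<forall>t \<omega>. t \<in> max_dom \<sigma> f \<omega> (\<eta> \<omega>) \<and> \<eta> (\<sigma> t \<omega>) = max_sol \<sigma> f t \<omega> (\<eta> \<omega>))"

definition uniformly_exp_stable ::
  "(real \<Rightarrow> 'w::topological_space \<Rightarrow> 'w) \<Rightarrow> ('w \<Rightarrow> real \<Rightarrow> real) \<Rightarrow> ('w \<times> real) set \<Rightarrow> bool" where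
  "uniformly_exp_stable \<sigma> f K \<longleftrightarrow>
     compact K \<and> tau_invariant \<sigma> f K \<and>
     (\<exists>\<delta>>0. \<exists>\<kappa>\<ge>1. \<exists>\<gamma>>0. \<forall>\<omega> y0 x0. (\<omega>, y0) \<in> K \<and> \<bar>y0 - x0\<bar> < \<delta> \<longrightarrow>
        (\<forall>t\<ge>0. t \<in> max_dom \<sigma> f \<omega> x0 \<and>
           \<bar>max_sol \<sigma> f t \<omega> y0 - max_sol \<sigma> f t \<omega> x0\<bar> \<le> \<kappa> * exp (- \<gamma> * t) * \<bar>y0 - x0\<bar>))"

definition attracts_exponentially ::
  "(real \<Rightarrow> 'w \<Rightarrow> 'w) \<Rightarrow> ('w \<Rightarrow> real \<Rightarrow> real) \<Rightarrow> ('w \<Rightarrow> real) \<Rightarrow> bool" where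
  "attracts_exponentially \<sigma> f \<eta> \<longleftrightarrow>
     (\<forall>\<omega> x0. \<exists>C>0. \<exists>\<gamma>>0. \<forall>t\<ge>0. t \<in> max_dom \<sigma> f \<omega> x0 \<and>
        \<bar>max_sol \<sigma> f t \<omega> x0 - \<eta> (\<sigma> t \<omega>)\<bar> \<le> C * exp (- \<gamma> * t))"

section \<open>The family of equations\<close>

definition family_rhs ::
  "('w \<Rightarrow> real) \<Rightarrow> ('w \<Rightarrow> real) \<Rightarrow> ('w \<Rightarrow> real \<Rightarrow> real) \<Rightarrow> 'w \<Rightarrow> real \<Rightarrow> real" where
  "family_rhs a b g \<omega> x = a \<omega> * x + b \<omega> + g \<omega> x"

end

theory Submission
  imports Defs
begin

text \<open>
  Write \<open>f = a x + b + g\<close>. The sign conditions on \<open>g\<close> together with \<open>g\<^sub>x \<le> 0\<close> outside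
  \<open>[r1, r2]\<close> make \<open>g \<omega>\<close> nonincreasing on the whole line, so the nonlinearity can only bring two
  solutions of the same equation closer than the linear part does: if \<open>d\<close> is their difference, then
  \<open>d d' \<le> a d\<^sup>2\<close> and hence \<open>\<bar>d t\<bar> \<le> \<bar>d 0\<bar> exp (\<integral>\<^sub>0\<^sup>t a)\<close> for \<open>t \<ge> 0\<close>.

  The hypothesis \<open>sup \<Sigma>\<^sub>a < 0\<close> makes that exponential decay uniformly. Every \<open>x' = (a - s) x\<close> with
  \<open>s \<ge> 0\<close> has an exponential dichotomy, which is either a forward decay or a backward decay. Both
  alternatives are open in \<open>s\<close> and they exclude each other; for large \<open>s\<close> the first one holds. As
  the half-line is connected, the first one holds for \<open>s = 0\<close>. Consequently
  \<open>\<bar>d t\<bar> \<le> \<kappa> e\<^sup>-\<^sup>\<gamma>\<^sup>t \<bar>d 0\<bar>\<close>, uniformly over the base, for every pair of solutions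
  (\<open>max_sol_contraction\<close>).

  This contraction decides the structure of a compact invariant set. Two points over the same \<open>\<omega>\<close>,
  each in some compact invariant set, can be pulled back along the flow for an arbitrarily long time
  and stay at bounded distance from each other, so they coincide (\<open>invariant_fibres_agree\<close>). A
  nonempty compact invariant set projects onto the minimal base, hence there is at most one such
  set, and it is the graph of a function, continuous because the graph is compact. The attractor
  is compact and invariant, and the estimates of stability and attraction are the contraction
  itself.

  Nonemptiness of the attractor and the stability claims need that all solutions exist for
  \<open>t \<ge> 0\<close>. Superlinear dissipation makes \<open>f\<close> point inwards at \<open>\<plusminus>M\<close> for large \<open>M\<close>, so a solution
  of the equation with truncated right-hand side, which is bounded and Lipschitz and therefore
  globally solvable by Picard's contraction argument, never leaves the region where the truncation
  is inactive.
\<close>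

section \<open>Scalar differential equations and inequalities\<close>

text \<open>This is the estimate that makes the integral operator a contraction in the norm with weight
  \<open>exp (k * \<bar>t\<bar>)\<close>: integration against the weight gains a factor \<open>1 / k\<close>.\<close>

lemma exp_weighted_primitive_bound:
  fixes P :: "real \<Rightarrow> real"
  assumes k: "k > 0" and P0: "P 0 = 0"
    and der: "\<And>s. (P has_real_derivative P' s) (at s)"
    and bound: "\<And>s. \<bar>P' s\<bar> \<le> c * exp (k * \<bar>s\<bar>)"
  shows "\<bar>P t\<bar> \<le> c / k * exp (k * \<bar>t\<bar>)"
proof -
  have c: "c \<ge> 0"
    using bound[of 0] by simp
  have upper: "Q t \<le> c / k * exp (k * t)"
    if t: "t \<ge> 0" and Q0: "Q 0 = 0"
      and Qd: "\<And>s. (Q has_real_derivative Q' s) (at s)"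
      and Qb: "\<And>s. s \<ge> 0 \<Longrightarrow> Q' s \<le> c * exp (k * s)"
    for t and Q Q' :: "real \<Rightarrow> real"
  proof -
    have "c / k * exp (k * 0) - Q 0 \<le> c / k * exp (k * t) - Q t"
    proof (rule DERIV_nonneg_imp_nondecreasing[OF t])
      fix s :: real assume s: "0 \<le> s" "s \<le> t"
      have "((\<lambda>s. c / k * exp (k * s) - Q s) has_real_derivative c * exp (k * s) - Q' s) (at s)"
        using k by (auto intro!: derivative_eq_intros Qd)
      then show "\<exists>y. ((\<lambda>s. c / k * exp (k * s) - Q s) has_real_derivative y) (at s) \<and> 0 \<le> y"
        using Qb[OF s(1)] by (metis diff_ge_0_iff_ge)
    qed
    moreover have "0 \<le> c / k"
      using c k by simp
    ultimately show ?thesis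
      using Q0 by simp
  qed
  have Pm: "((\<lambda>s. P (- s)) has_real_derivative - P' (- s)) (at s)" for s
    by (rule DERIV_cong, rule DERIV_chain2[where f = P and g = uminus, OF der])
       (auto intro!: derivative_eq_intros)
  have bounds: "P' s \<le> c * exp (k * s)" "- P' s \<le> c * exp (k * s)"
      "P' (- s) \<le> c * exp (k * s)" "- P' (- s) \<le> c * exp (k * s)" if "s \<ge> 0" for s
    using bound[of s] bound[of "- s"] that by auto
  show ?thesis
  proof (cases "t \<ge> 0")
    case True
    have "P t \<le> c / k * exp (k * t)"
      by (rule upper[OF True P0 der]) (use bounds in auto)
    moreover have "- P t \<le> c / k * exp (k * t)"
      by (rule upper[OF True _ DERIV_minus[OF der]]) (use bounds P0 in auto)
    ultimately show ?thesis
      using True by (auto simp: abs_le_iff)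
  next
    case False
    then have t: "- t \<ge> 0" by simp
    have "P (- (- t)) \<le> c / k * exp (k * (- t))"
      by (rule upper[OF t _ Pm]) (use bounds P0 in auto)
    moreover have "- P (- (- t)) \<le> c / k * exp (k * (- t))"
      by (rule upper[OF t _ DERIV_minus[OF Pm]]) (use bounds P0 in auto)
    ultimately show ?thesis
      using False by (auto simp: abs_le_iff)
  qed
qed

lemma LBINT_continuous_has_real_derivative:
  fixes h :: "real \<Rightarrow> real"
  assumes "continuous_on UNIV h"
  shows "((\<lambda>t. LBINT s=ereal 0..ereal t. h s) has_real_derivative h t) (at t)"
proof -
  define m where "m = \<bar>t\<bar> + 1"
  have "((\<lambda>t. LBINT s=ereal 0..ereal t. h s) has_vector_derivative h t) (at t within {- m..m})"
    by (rule interval_integral_FTC2)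
       (auto simp: m_def intro: continuous_on_subset[OF assms])
  moreover have "t \<in> interior {- m..m}"
    by (auto simp: m_def)
  ultimately show ?thesis
    by (metis at_within_interior has_real_derivative_iff_has_vector_derivative)
qed

text \<open>Picard's theorem, in one step on the whole line. The unknown is written as
  \<open>x0 + exp (k * \<bar>t\<bar>) * v t\<close> with \<open>v\<close> bounded and continuous. For \<open>k\<close> at least twice the Lipschitz
  constant the integral equation is a contraction for the supremum norm of \<open>v\<close>, so no gluing of
  local solutions is necessary.\<close>

lemma bounded_lipschitz_ode_global_solution:
  fixes H :: "real \<Rightarrow> real \<Rightarrow> real"
  assumes cont: "continuous_on UNIV (\<lambda>(t, x). H t x)"
    and bdd: "\<And>t x. \<bar>H t x\<bar> \<le> B"
    and lip: "\<And>t x y. \<bar>H t x - H t y\<bar> \<le> L * \<bar>x - y\<bar>"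
  obtains u where "u 0 = x0" "\<And>t. (u has_real_derivative H t (u t)) (at t)"
proof -
  define k where "k = 2 * (\<bar>L\<bar> + 1)"
  define W where "W t = exp (k * \<bar>t\<bar>)" for t :: real
  define F where "F v s = H s (x0 + W s * v s)" for v s
  define J where "J v t = (LBINT s=ereal 0..ereal t. F v s)" for v t
  define \<Phi> :: "(real \<Rightarrow>\<^sub>C real) \<Rightarrow> (real \<Rightarrow>\<^sub>C real)"
    where "\<Phi> v = Bcontfun (\<lambda>t. J (apply_bcontfun v) t / W t)" for v
  have k: "k > 0" and W: "W t > 0" and W1: "W t \<ge> 1" for t
    by (auto simp: k_def W_def)
  have contW: "continuous_on UNIV W"
    unfolding W_def by (intro continuous_intros)
  have contF: "continuous_on UNIV (F (apply_bcontfun v))" for v :: "real \<Rightarrow>\<^sub>C real"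
  proof -
    have "continuous_on UNIV ((\<lambda>(t, x). H t x) \<circ> (\<lambda>s. (s, x0 + W s * apply_bcontfun v s)))"
      by (intro continuous_on_compose continuous_intros contW continuous_on_subset[OF cont]) auto
    then show ?thesis
      by (simp add: F_def o_def)
  qed
  have J_deriv: "(J (apply_bcontfun v) has_real_derivative F (apply_bcontfun v) t) (at t)"
    for v :: "real \<Rightarrow>\<^sub>C real" and t
    unfolding J_def by (rule LBINT_continuous_has_real_derivative[OF contF])
  have J0: "J v 0 = 0" for v
    by (simp add: J_def)
  have B: "0 \<le> B"
    using bdd[of 0 0] by linarith
  have J_bound: "\<bar>J (apply_bcontfun v) t\<bar> \<le> B / k * W t" for v :: "real \<Rightarrow>\<^sub>C real" and t
    unfolding W_def
  proof (rule exp_weighted_primitive_bound[OF k J0 J_deriv])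
    fix s
    have "B * 1 \<le> B * W s"
      by (rule mult_left_mono[OF W1 B])
    then show "\<bar>F (apply_bcontfun v) s\<bar> \<le> B * exp (k * \<bar>s\<bar>)"
      using bdd[of s "x0 + W s * apply_bcontfun v s"] by (simp add: F_def W_def)
  qed
  have \<Phi>: "apply_bcontfun (\<Phi> v) t = J (apply_bcontfun v) t / W t" for v t
  proof -
    have "(\<lambda>t. J (apply_bcontfun v) t / W t) \<in> bcontfun"
    proof (rule bcontfun_normI)
      have "continuous_on UNIV (J (apply_bcontfun v))"
        by (meson J_deriv DERIV_continuous_on has_field_derivative_at_within)
      then show "continuous_on UNIV (\<lambda>t. J (apply_bcontfun v) t / W t)"
        using W by (intro continuous_intros contW) (auto simp: less_imp_neq[symmetric])
      show "norm (J (apply_bcontfun v) t / W t) \<le> B / k" for t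
        using J_bound[of v t] W[of t] by (simp add: abs_divide pos_divide_le_eq)
    qed
    then show ?thesis
      by (simp add: \<Phi>_def Bcontfun_inverse)
  qed
  have contraction: "dist (\<Phi> v) (\<Phi> w) \<le> 1 / 2 * dist v w" for v w
  proof (rule dist_bound)
    fix t
    have "\<bar>J (apply_bcontfun v) t - J (apply_bcontfun w) t\<bar>
        \<le> (\<bar>L\<bar> * dist v w) / k * exp (k * \<bar>t\<bar>)"
    proof (rule exp_weighted_primitive_bound[OF k _ DERIV_diff[OF J_deriv J_deriv]])
      show "J (apply_bcontfun v) 0 - J (apply_bcontfun w) 0 = 0"
        by (simp add: J0)
      fix s
      have "\<bar>F (apply_bcontfun v) s - F (apply_bcontfun w) s\<bar>
          \<le> L * \<bar>W s * apply_bcontfun v s - W s * apply_bcontfun w s\<bar>"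
        using lip[of s "x0 + W s * apply_bcontfun v s" "x0 + W s * apply_bcontfun w s"]
        by (simp add: F_def)
      also have "\<dots> = L * (W s * dist (apply_bcontfun v s) (apply_bcontfun w s))"
        using W[of s] by (simp add: dist_real_def abs_mult flip: right_diff_distrib)
      also have "\<dots> \<le> \<bar>L\<bar> * (W s * dist v w)"
        by (intro mult_mono dist_bounded) (use W[of s] in auto)
      finally show "\<bar>F (apply_bcontfun v) s - F (apply_bcontfun w) s\<bar>
          \<le> \<bar>L\<bar> * dist v w * exp (k * \<bar>s\<bar>)"
        by (simp add: W_def mult_ac)
    qed
    also have "\<dots> \<le> 1 / 2 * dist v w * W t"
    proof -
      have "\<bar>L\<bar> / k \<le> 1 / 2"
        by (simp add: k_def divide_simps)
      then have "\<bar>L\<bar> / k * dist v w \<le> 1 / 2 * dist v w"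
        by (rule mult_right_mono) simp
      then have "\<bar>L\<bar> / k * dist v w * W t \<le> 1 / 2 * dist v w * W t"
        by (rule mult_right_mono) (use W[of t] in simp)
      then show ?thesis
        by (simp add: W_def)
    qed
    finally show "dist (apply_bcontfun (\<Phi> v) t) (apply_bcontfun (\<Phi> w) t) \<le> 1 / 2 * dist v w"
      using W[of t] by (simp add: \<Phi> dist_real_def pos_divide_le_eq flip: diff_divide_distrib)
  qed
  then obtain v where v: "\<Phi> v = v"
    using banach_fix_type[of "1 / 2" \<Phi>] by auto
  define u where "u t = x0 + J (apply_bcontfun v) t" for t
  have u: "u t = x0 + W t * apply_bcontfun v t" for t
    using \<Phi>[of v t] W[of t] by (simp add: u_def v)
  show thesis
  proof
    show "u 0 = x0"
      by (simp add: u_def J0)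
    show "(u has_real_derivative H t (u t)) (at t)" for t
    proof -
      have "(u has_real_derivative F (apply_bcontfun v) t) (at t)"
        unfolding u_def by (auto intro!: derivative_eq_intros J_deriv)
      then show ?thesis
        by (simp add: F_def u)
    qed
  qed
qed

text \<open>Gronwall's inequality in a one-sided form: multiplying by \<open>d\<close> removes the need to know the
  sign of \<open>d\<close>, as \<open>d\<^sup>2 exp (- 2 P)\<close> is nonincreasing.\<close>

lemma one_sided_gronwall:
  fixes d P :: "real \<Rightarrow> real"
  assumes t: "0 \<le> t"
    and d: "\<And>s. 0 \<le> s \<Longrightarrow> s \<le> t \<Longrightarrow> (d has_real_derivative d' s) (at s)"
    and P: "\<And>s. 0 \<le> s \<Longrightarrow> s \<le> t \<Longrightarrow> (P has_real_derivative p s) (at s)"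
    and ineq: "\<And>s. 0 \<le> s \<Longrightarrow> s \<le> t \<Longrightarrow> d' s * d s \<le> p s * (d s)\<^sup>2"
  shows "\<bar>d t\<bar> \<le> \<bar>d 0\<bar> * exp (P t - P 0)"
proof -
  let ?E = "\<lambda>s. (d s)\<^sup>2 * exp (- 2 * P s)"
  have "?E t \<le> ?E 0"
  proof (rule DERIV_nonpos_imp_nonincreasing[OF t])
    fix s assume s: "0 \<le> s" "s \<le> t"
    have "(?E has_real_derivative 2 * (d' s * d s - p s * (d s)\<^sup>2) * exp (- 2 * P s)) (at s)"
      by (auto intro!: derivative_eq_intros d[OF s] P[OF s] simp: algebra_simps power2_eq_square)
    moreover have "2 * (d' s * d s - p s * (d s)\<^sup>2) * exp (- 2 * P s) \<le> 0"
      using ineq[OF s] by (simp add: mult_le_0_iff)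
    ultimately show "\<exists>y. (?E has_real_derivative y) (at s) \<and> y \<le> 0"
      by blast
  qed
  then have "(d t)\<^sup>2 * exp (- 2 * P t) * exp (2 * P t) \<le> (d 0)\<^sup>2 * exp (- 2 * P 0) * exp (2 * P t)"
    by (rule mult_right_mono) simp
  then have "(d t)\<^sup>2 \<le> (d 0)\<^sup>2 * exp (2 * (P t - P 0))"
    by (simp add: mult.assoc algebra_simps flip: exp_add)
  also have "\<dots> = (\<bar>d 0\<bar> * exp (P t - P 0))\<^sup>2"
    by (simp add: power_mult_distrib flip: exp_double)
  finally show ?thesis
    by (simp add: abs_le_square_iff[symmetric] abs_mult)
qed

text \<open>After the last time at which \<open>u \<le> M\<close> the function would have to grow from \<open>M\<close>, although its
  derivative is nonpositive there.\<close>

lemma upper_barrier: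
  fixes u :: "real \<Rightarrow> real"
  assumes t: "0 \<le> t"
    and u: "\<And>s. 0 \<le> s \<Longrightarrow> s \<le> t \<Longrightarrow> (u has_real_derivative u' s) (at s)"
    and u0: "u 0 \<le> M"
    and barrier: "\<And>s. 0 \<le> s \<Longrightarrow> s \<le> t \<Longrightarrow> u s > M \<Longrightarrow> u' s \<le> 0"
  shows "u t \<le> M"
proof (rule ccontr)
  assume "\<not> u t \<le> M"
  define S where "S = {0..t} \<inter> u -` {..M}"
  have cont: "continuous_on {0..t} u"
    by (meson DERIV_atLeastAtMost_imp_continuous_on u)
  have "closed S"
    unfolding S_def by (rule continuous_closed_preimage[OF cont]) auto
  then have "compact S"
    by (metis S_def bounded_Int bounded_closed_interval compact_eq_bounded_closed)
  moreover have "0 \<in> S"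
    using t u0 by (simp add: S_def)
  ultimately obtain s where s: "s \<in> S" "\<And>r. r \<in> S \<Longrightarrow> r \<le> s"
    using compact_attains_sup[of S] by blast
  then have s_bounds: "0 \<le> s" "s < t" "u s \<le> M"
    using \<open>\<not> u t \<le> M\<close> by (auto simp: S_def order_le_less)
  then obtain z where z: "s < z" "z < t" "u t - u s = (t - s) * u' z"
    using MVT2[of s t u u'] u by auto
  then have "z \<notin> S"
    using s(2) by force
  then have "u' z \<le> 0"
    using barrier[of z] z s_bounds by (auto simp: S_def)
  then have "u t \<le> u s"
    using z s_bounds by (metis diff_ge_0_iff_ge diff_le_0_iff_le less_imp_le mult_nonneg_nonpos)
  then show False
    using \<open>\<not> u t \<le> M\<close> s_bounds by simp
qed

section \<open>Integrals along orbits and the spectrum\<close>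

definition orbit_integral :: "(real \<Rightarrow> 'w \<Rightarrow> 'w) \<Rightarrow> ('w \<Rightarrow> real) \<Rightarrow> 'w \<Rightarrow> real \<Rightarrow> real" where
  "orbit_integral \<sigma> c \<omega> t = (LBINT l=ereal 0..ereal t. c (\<sigma> l \<omega>))"

lemma flow_zero: "continuous_flow \<sigma> \<Longrightarrow> \<sigma> 0 \<omega> = \<omega>"
  and flow_add: "continuous_flow \<sigma> \<Longrightarrow> \<sigma> (s + t) \<omega> = \<sigma> s (\<sigma> t \<omega>)"
  by (simp_all add: continuous_flow_def)

lemma flow_inverse: "continuous_flow \<sigma> \<Longrightarrow> \<sigma> (- t) (\<sigma> t \<omega>) = \<omega>"
  by (metis add.left_inverse flow_add flow_zero)

lemma continuous_on_orbit:
  assumes "continuous_flow \<sigma>"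
  shows "continuous_on UNIV (\<lambda>t. \<sigma> t \<omega>)"
proof -
  have "continuous_on UNIV ((\<lambda>(t, \<omega>). \<sigma> t \<omega>) \<circ> (\<lambda>t. (t, \<omega>)))"
    using assms unfolding continuous_flow_def
    by (intro continuous_on_compose continuous_intros) (auto intro: continuous_on_subset)
  then show ?thesis
    by (simp add: o_def)
qed

lemma orbit_integral_has_real_derivative:
  assumes "continuous_flow \<sigma>" "continuous_on UNIV c"
  shows "(orbit_integral \<sigma> c \<omega> has_real_derivative c (\<sigma> t \<omega>)) (at t)"
proof -
  have "continuous_on UNIV (\<lambda>t. c (\<sigma> t \<omega>))"
    by (rule continuous_on_compose2[OF assms(2) continuous_on_orbit[OF assms(1)]]) auto
  from LBINT_continuous_has_real_derivative[OF this] show ?thesis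
    by (simp add: orbit_integral_def[abs_def])
qed

lemma orbit_integral_zero [simp]: "orbit_integral \<sigma> c \<omega> 0 = 0"
  by (simp add: orbit_integral_def)

lemma orbit_integral_eqI:
  assumes "continuous_flow \<sigma>" "continuous_on UNIV c" "Q 0 = 0"
    and "\<And>t. (Q has_real_derivative c (\<sigma> t \<omega>)) (at t)"
  shows "orbit_integral \<sigma> c \<omega> t = Q t"
proof -
  have "((\<lambda>t. orbit_integral \<sigma> c \<omega> t - Q t) has_real_derivative 0) (at t)" for t
    using DERIV_diff[OF orbit_integral_has_real_derivative[OF assms(1,2), of \<omega>] assms(4)[of t]] by simp
  then have "orbit_integral \<sigma> c \<omega> t - Q t = orbit_integral \<sigma> c \<omega> 0 - Q 0"
    by (intro DERIV_isconst_all) auto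
  then show ?thesis
    using assms(3) by simp
qed

lemma orbit_integral_shift:
  assumes "continuous_flow \<sigma>" "continuous_on UNIV c"
  shows "orbit_integral \<sigma> (\<lambda>\<omega>. c \<omega> - s) \<omega> t = orbit_integral \<sigma> c \<omega> t - s * t"
  by (rule orbit_integral_eqI)
     (auto intro!: derivative_eq_intros continuous_intros assms
        orbit_integral_has_real_derivative)

lemma orbit_integral_reverse:
  assumes "continuous_flow \<sigma>" "continuous_on UNIV c"
  shows "orbit_integral \<sigma> c (\<sigma> t \<omega>) (- t) = - orbit_integral \<sigma> c \<omega> t"
proof -
  have "orbit_integral \<sigma> c (\<sigma> t \<omega>) s = orbit_integral \<sigma> c \<omega> (s + t) - orbit_integral \<sigma> c \<omega> t" for s
  proof (rule orbit_integral_eqI[OF assms])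
    fix s
    have "((\<lambda>s. orbit_integral \<sigma> c \<omega> (s + t)) has_real_derivative c (\<sigma> (s + t) \<omega>) * 1) (at s)"
      by (rule DERIV_chain2[OF orbit_integral_has_real_derivative[OF assms]])
         (auto intro!: derivative_eq_intros)
    then show "((\<lambda>s. orbit_integral \<sigma> c \<omega> (s + t) - orbit_integral \<sigma> c \<omega> t)
        has_real_derivative c (\<sigma> s (\<sigma> t \<omega>))) (at s)"
      by (auto intro!: derivative_eq_intros simp: flow_add[OF assms(1)])
  qed simp
  from this[of "- t"] show ?thesis
    by simp
qed

text \<open>The constants of the dichotomy are parameters here because a shift of \<open>c\<close> by a constant changes
  \<open>\<gamma>\<close> by the same constant and leaves \<open>\<kappa>\<close> alone. This is what makes both alternatives open.\<close>

definition forward_decay :: "(real \<Rightarrow> 'w \<Rightarrow> 'w) \<Rightarrow> ('w \<Rightarrow> real) \<Rightarrow> real \<Rightarrow> real \<Rightarrow> bool" where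
  "forward_decay \<sigma> c \<kappa> \<gamma> \<longleftrightarrow>
     (\<forall>\<omega>. \<forall>t\<ge>0. exp (orbit_integral \<sigma> c \<omega> t) \<le> \<kappa> * exp (- \<gamma> * t))"

definition backward_decay :: "(real \<Rightarrow> 'w \<Rightarrow> 'w) \<Rightarrow> ('w \<Rightarrow> real) \<Rightarrow> real \<Rightarrow> real \<Rightarrow> bool" where
  "backward_decay \<sigma> c \<kappa> \<gamma> \<longleftrightarrow>
     (\<forall>\<omega>. \<forall>t\<le>0. exp (orbit_integral \<sigma> c \<omega> t) \<le> \<kappa> * exp (\<gamma> * t))"

lemma exp_dichotomy_iff:
  "exp_dichotomy \<sigma> c \<longleftrightarrow>
     (\<exists>\<kappa>\<ge>1. \<exists>\<gamma>>0. forward_decay \<sigma> c \<kappa> \<gamma>) \<or> (\<exists>\<kappa>\<ge>1. \<exists>\<gamma>>0. backward_decay \<sigma> c \<kappa> \<gamma>)"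
  by (auto simp: exp_dichotomy_def forward_decay_def backward_decay_def orbit_integral_def)

lemma forward_decay_shift:
  assumes "continuous_flow \<sigma>" "continuous_on UNIV c"
  shows "forward_decay \<sigma> (\<lambda>\<omega>. c \<omega> - s) \<kappa> \<gamma> \<longleftrightarrow>
    (\<forall>\<omega>. \<forall>t\<ge>0. exp (orbit_integral \<sigma> c \<omega> t) \<le> \<kappa> * exp ((s - \<gamma>) * t))"
  unfolding forward_decay_def orbit_integral_shift[OF assms]
  by (simp add: exp_diff pos_divide_le_eq mult.assoc left_diff_distrib exp_minus field_simps)

lemma backward_decay_shift:
  assumes "continuous_flow \<sigma>" "continuous_on UNIV c"
  shows "backward_decay \<sigma> (\<lambda>\<omega>. c \<omega> - s) \<kappa> \<gamma> \<longleftrightarrow>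
    (\<forall>\<omega>. \<forall>t\<le>0. exp (orbit_integral \<sigma> c \<omega> t) \<le> \<kappa> * exp ((s + \<gamma>) * t))"
  unfolding backward_decay_def orbit_integral_shift[OF assms]
  by (simp add: exp_diff pos_divide_le_eq mult.assoc distrib_right exp_add field_simps)

text \<open>Following an orbit backwards from its endpoint inverts \<open>exp (\<integral> c)\<close>, so the product of the
  forward and the backward bound would have to stay above \<open>1\<close> while it tends to \<open>0\<close>.\<close>

lemma forward_backward_decay_exclusive:
  assumes "continuous_flow \<sigma>" "continuous_on UNIV c"
    and "\<gamma>1 > 0" "\<gamma>2 > 0"
    and fwd: "forward_decay \<sigma> c \<kappa>1 \<gamma>1" and bwd: "backward_decay \<sigma> c \<kappa>2 \<gamma>2"
  shows False
proof -
  fix \<omega>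
  have "1 \<le> \<kappa>1 * \<kappa>2 * exp (- (\<gamma>1 + \<gamma>2) * t)" if "t \<ge> 0" for t
  proof -
    have f: "exp (orbit_integral \<sigma> c \<omega> t) \<le> \<kappa>1 * exp (- \<gamma>1 * t)"
      using fwd that by (auto simp: forward_decay_def)
    have b: "exp (orbit_integral \<sigma> c (\<sigma> t \<omega>) (- t)) \<le> \<kappa>2 * exp (\<gamma>2 * - t)"
      using bwd that unfolding backward_decay_def by (metis neg_le_0_iff_le)
    have "1 = exp (orbit_integral \<sigma> c \<omega> t) * exp (orbit_integral \<sigma> c (\<sigma> t \<omega>) (- t))"
      by (simp add: orbit_integral_reverse[OF assms(1,2)] flip: exp_add)
    also have "\<dots> \<le> (\<kappa>1 * exp (- \<gamma>1 * t)) * (\<kappa>2 * exp (\<gamma>2 * - t))"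
      using f by (intro mult_mono f b) (auto intro: order_trans[OF exp_ge_zero])
    also have "\<dots> = \<kappa>1 * \<kappa>2 * exp (- (\<gamma>1 + \<gamma>2) * t)"
      by (simp add: algebra_simps flip: exp_add)
    finally show ?thesis .
  qed
  then have "eventually (\<lambda>t. 1 \<le> \<kappa>1 * \<kappa>2 * exp (- (\<gamma>1 + \<gamma>2) * t)) at_top"
    by (auto intro: eventually_at_top_linorderI[of 0])
  moreover have "((\<lambda>t. exp (- (\<gamma>1 + \<gamma>2) * t)) \<longlongrightarrow> 0) at_top"
    using assms(3,4)
    by (intro filterlim_compose[OF exp_at_bot] filterlim_tendsto_neg_mult_at_bot[OF tendsto_const])
       (auto simp: filterlim_ident)
  then have "((\<lambda>t. \<kappa>1 * \<kappa>2 * exp (- (\<gamma>1 + \<gamma>2) * t)) \<longlongrightarrow> 0) at_top"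
    by (rule tendsto_mult_right_zero)
  ultimately show False
    using tendsto_lowerbound[of _ 0 at_top 1] by fastforce
qed

text \<open>For \<open>s\<close> above the maximum of \<open>\<bar>a\<bar>\<close> the equation \<open>x' = (a - s) x\<close> decays forward; in
  particular the spectrum is bounded above, so its supremum is an upper bound and every \<open>s \<ge> 0\<close>
  admits a dichotomy. Let \<open>i\<close> be the infimum of the \<open>s \<ge> 0\<close> with forward decay. Backward decay at
  \<open>i\<close> would extend to some larger parameter with forward decay, which is impossible. So there is
  forward decay at \<open>i\<close>, and it extends to smaller parameters unless \<open>i = 0\<close>.\<close>

lemma spectrum_negative_imp_forward_decay:
  fixes \<sigma> :: "real \<Rightarrow> 'w::topological_space \<Rightarrow> 'w"
  assumes comp: "compact (UNIV :: 'w set)"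
    and flow: "continuous_flow \<sigma>" and conta: "continuous_on UNIV a"
    and neg: "Sup (sacker_sell_spectrum \<sigma> a) < 0"
  obtains \<kappa> \<gamma> where "\<kappa> \<ge> 1" "\<gamma> > 0" "forward_decay \<sigma> a \<kappa> \<gamma>"
proof -
  define S where "S = {s. s \<ge> 0 \<and> (\<exists>\<kappa>\<ge>1. \<exists>\<gamma>>0. forward_decay \<sigma> (\<lambda>\<omega>. a \<omega> - s) \<kappa> \<gamma>)}"
  obtain \<alpha> where \<alpha>: "\<And>\<omega>. \<bar>a \<omega>\<bar> \<le> \<alpha>"
    using compact_imp_bounded[OF compact_continuous_image[OF conta comp]]
    by (auto simp: bounded_iff)
  have \<alpha>0: "\<alpha> \<ge> 0"
    using \<alpha>[of undefined] by linarith
  have large: "forward_decay \<sigma> (\<lambda>\<omega>. a \<omega> - s) 1 (s - \<alpha>)" for s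
    unfolding forward_decay_shift[OF flow conta]
  proof (intro allI impI)
    fix \<omega> and t :: real assume t: "t \<ge> 0"
    have "orbit_integral \<sigma> a \<omega> t - \<alpha> * t \<le> orbit_integral \<sigma> a \<omega> 0 - \<alpha> * 0"
    proof (rule DERIV_nonpos_imp_nonincreasing[OF t])
      fix x
      have "((\<lambda>t. orbit_integral \<sigma> a \<omega> t - \<alpha> * t) has_real_derivative a (\<sigma> x \<omega>) - \<alpha>) (at x)"
        by (auto intro!: derivative_eq_intros orbit_integral_has_real_derivative flow conta)
      then show "\<exists>y. ((\<lambda>t. orbit_integral \<sigma> a \<omega> t - \<alpha> * t) has_real_derivative y) (at x) \<and> y \<le> 0"
        using \<alpha>[of "\<sigma> x \<omega>"] by (intro exI[of _ "a (\<sigma> x \<omega>) - \<alpha>"]) auto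
    qed
    then show "exp (orbit_integral \<sigma> a \<omega> t) \<le> 1 * exp ((s - (s - \<alpha>)) * t)"
      by simp
  qed
  have bdd: "bdd_above (sacker_sell_spectrum \<sigma> a)"
  proof (rule bdd_aboveI[of _ \<alpha>])
    fix s assume s: "s \<in> sacker_sell_spectrum \<sigma> a"
    show "s \<le> \<alpha>"
    proof (rule ccontr)
      assume "\<not> s \<le> \<alpha>"
      then have "\<exists>\<kappa>\<ge>1. \<exists>\<gamma>>0. forward_decay \<sigma> (\<lambda>\<omega>. a \<omega> - s) \<kappa> \<gamma>"
        using large[of s] by (intro exI[of _ 1] conjI exI[of _ "s - \<alpha>"]) auto
      then show False
        using s unfolding sacker_sell_spectrum_def exp_dichotomy_iff by blast
    qed
  qed
  have dich: "exp_dichotomy \<sigma> (\<lambda>\<omega>. a \<omega> - s)" if "s \<ge> 0" for s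
    using cSup_upper[OF _ bdd, of s] neg that by (force simp: sacker_sell_spectrum_def)
  have cont: "continuous_on UNIV (\<lambda>\<omega>. a \<omega> - s)" for s
    by (intro continuous_intros conta)
  have ne: "S \<noteq> {}"
    using large[of "\<alpha> + 1"] \<alpha>0 by (force simp: S_def)
  have S_bdd: "bdd_below S"
    by (auto simp: S_def intro: bdd_belowI[of _ 0])
  define i where "i = Inf S"
  have i0: "i \<ge> 0"
    unfolding i_def by (rule cInf_greatest[OF ne]) (auto simp: S_def)
  have "\<not> backward_decay \<sigma> (\<lambda>\<omega>. a \<omega> - i) \<kappa> \<gamma>" if \<gamma>: "\<gamma> > 0" and \<kappa>: "\<kappa> \<ge> 1" for \<kappa> \<gamma>
  proof
    assume bwd: "backward_decay \<sigma> (\<lambda>\<omega>. a \<omega> - i) \<kappa> \<gamma>"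
    obtain s where s: "s \<in> S" "s < i + \<gamma>"
      using cInf_lessD[OF ne, of "i + \<gamma>"] \<gamma> unfolding i_def by auto
    \<comment> \<open>The backward alternative at \<open>i\<close> persists up to \<open>s\<close>, where forward decay holds.\<close>
    have "backward_decay \<sigma> (\<lambda>\<omega>. a \<omega> - s) \<kappa> (i + \<gamma> - s)"
      using bwd by (simp add: backward_decay_shift[OF flow conta])
    moreover obtain \<kappa>' \<gamma>' where "\<gamma>' > 0" "forward_decay \<sigma> (\<lambda>\<omega>. a \<omega> - s) \<kappa>' \<gamma>'"
      using s(1) by (auto simp: S_def)
    ultimately show False
      using forward_backward_decay_exclusive[OF flow cont] s(2) by (meson diff_gt_0_iff_gt)
  qed
  then obtain \<kappa> \<gamma> where \<kappa>\<gamma>: "\<kappa> \<ge> 1" "\<gamma> > 0" and fwd: "forward_decay \<sigma> (\<lambda>\<omega>. a \<omega> - i) \<kappa> \<gamma>"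
    using dich[OF i0] by (auto simp: exp_dichotomy_iff)
  have "i = 0"
  proof (rule ccontr)
    assume "i \<noteq> 0"
    define s where "s = max 0 (i - \<gamma> / 2)"
    have s: "s \<ge> 0" "s < i" "s - i + \<gamma> > 0"
      using \<open>i \<noteq> 0\<close> i0 \<kappa>\<gamma> by (auto simp: s_def)
    have "forward_decay \<sigma> (\<lambda>\<omega>. a \<omega> - s) \<kappa> (s - i + \<gamma>)"
      using fwd by (simp add: forward_decay_shift[OF flow conta])
    then have "s \<in> S"
      using s \<kappa>\<gamma> by (auto simp: S_def)
    then show False
      using cInf_lower[OF _ S_bdd] s(2) by (force simp: i_def)
  qed
  then show thesis
    using fwd \<kappa>\<gamma> that by simp
qed

section \<open>The local flow of a dissipative family\<close>

text \<open>The one-sided bound \<open>a\<close> controls the rate at which solutions separate in forward time, the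
  local Lipschitz condition gives uniqueness in backward time, and the inward condition prevents
  blow-up in forward time.\<close>

locale dissipative_family =
  fixes \<sigma> :: "real \<Rightarrow> 'w::metric_space \<Rightarrow> 'w"
    and f :: "'w \<Rightarrow> real \<Rightarrow> real"
    and a :: "'w \<Rightarrow> real"
  assumes compact_base: "compact (UNIV :: 'w set)"
    and flow: "continuous_flow \<sigma>"
    and continuous_a: "continuous_on UNIV a"
    and continuous_f: "continuous_on UNIV (\<lambda>(\<omega>, x). f \<omega> x)"
    and lipschitz: "\<And>R. \<exists>L. \<forall>\<omega> x y. \<bar>x\<bar> \<le> R \<longrightarrow> \<bar>y\<bar> \<le> R \<longrightarrow> \<bar>f \<omega> x - f \<omega> y\<bar> \<le> L * \<bar>x - y\<bar>"
    and one_sided: "\<And>\<omega> x y. (f \<omega> x - f \<omega> y) * (x - y) \<le> a \<omega> * (x - y)\<^sup>2"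
    and inward: "\<exists>R. \<forall>\<omega> x. (x \<ge> R \<longrightarrow> f \<omega> x \<le> 0) \<and> (x \<le> - R \<longrightarrow> f \<omega> x \<ge> 0)"
begin

lemma solves_onD:
  assumes "solves_on \<sigma> f \<omega> x0 I u"
  shows "u 0 = x0"
    and "t \<in> I \<Longrightarrow> 0 \<le> s \<Longrightarrow> s \<le> t \<Longrightarrow> s \<in> I"
    and "t \<in> I \<Longrightarrow> s \<le> 0 \<Longrightarrow> t \<le> s \<Longrightarrow> s \<in> I"
    and "t \<in> I \<Longrightarrow> (u has_real_derivative f (\<sigma> t \<omega>) (u t)) (at t)"
  using assms unfolding solves_on_def is_interval_1 by blast+

lemma solution_contraction:
  assumes u: "solves_on \<sigma> f \<omega> x0 I u" and v: "solves_on \<sigma> f \<omega> y0 J v"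
    and t: "0 \<le> t" "t \<in> I" "t \<in> J"
  shows "\<bar>u t - v t\<bar> \<le> \<bar>x0 - y0\<bar> * exp (orbit_integral \<sigma> a \<omega> t)"
proof -
  have "\<bar>u t - v t\<bar> \<le> \<bar>u 0 - v 0\<bar> * exp (orbit_integral \<sigma> a \<omega> t - orbit_integral \<sigma> a \<omega> 0)"
  proof (rule one_sided_gronwall[where d = "\<lambda>t. u t - v t", OF t(1)])
    fix s assume s: "0 \<le> s" "s \<le> t"
    show "((\<lambda>t. u t - v t) has_real_derivative f (\<sigma> s \<omega>) (u s) - f (\<sigma> s \<omega>) (v s)) (at s)"
      by (intro DERIV_diff solves_onD(4)[OF u] solves_onD(4)[OF v]
          solves_onD(2)[OF u t(2) s] solves_onD(2)[OF v t(3) s])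
    show "(orbit_integral \<sigma> a \<omega> has_real_derivative a (\<sigma> s \<omega>)) (at s)"
      by (rule orbit_integral_has_real_derivative[OF flow continuous_a])
  qed (rule one_sided)
  then show ?thesis
    by (simp add: solves_onD(1)[OF u] solves_onD(1)[OF v])
qed

text \<open>Forward uniqueness is part of the contraction estimate. Backward in time the one-sided bound
  has the wrong sign, and a Lipschitz constant on the range of both solutions replaces it.\<close>

lemma solution_unique:
  assumes u: "solves_on \<sigma> f \<omega> x0 I u" and v: "solves_on \<sigma> f \<omega> x0 J v"
    and t: "t \<in> I" "t \<in> J"
  shows "u t = v t"
proof (cases "t \<ge> 0")
  case True
  then show ?thesis
    using solution_contraction[OF u v True t] by simp
next
  case False
  then have t0: "t \<le> 0" "0 \<le> - t" by auto
  have "continuous_on {t..0} u" "continuous_on {t..0} v"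
    by (auto intro!: continuous_at_imp_continuous_on DERIV_isCont
        solves_onD(4)[OF u] solves_onD(4)[OF v] solves_onD(3)[OF u t(1)] solves_onD(3)[OF v t(2)])
  then have "bounded (u ` {t..0} \<union> v ` {t..0})"
    by (simp add: compact_continuous_image compact_imp_bounded)
  then obtain R where R: "\<And>s. t \<le> s \<Longrightarrow> s \<le> 0 \<Longrightarrow> \<bar>u s\<bar> \<le> R \<and> \<bar>v s\<bar> \<le> R"
    by (force simp: bounded_iff)
  obtain L where L: "\<And>\<omega> x y. \<bar>x\<bar> \<le> R \<Longrightarrow> \<bar>y\<bar> \<le> R \<Longrightarrow> \<bar>f \<omega> x - f \<omega> y\<bar> \<le> L * \<bar>x - y\<bar>"
    using lipschitz[of R] by blast
  define d where "d s = u (- s) - v (- s)" for s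
  define d' where "d' s = - (f (\<sigma> (- s) \<omega>) (u (- s)) - f (\<sigma> (- s) \<omega>) (v (- s)))" for s
  have "\<bar>d (- t)\<bar> \<le> \<bar>d 0\<bar> * exp (L * (- t) - L * 0)"
  proof (rule one_sided_gronwall[OF t0(2)])
    fix s assume s: "0 \<le> s" "s \<le> - t"
    then have mem: "- s \<in> I" "- s \<in> J" and range: "\<bar>u (- s)\<bar> \<le> R" "\<bar>v (- s)\<bar> \<le> R"
      using solves_onD(3)[OF u t(1), of "- s"] solves_onD(3)[OF v t(2), of "- s"] R[of "- s"] by auto
    have "((\<lambda>r. u (- r)) has_real_derivative f (\<sigma> (- s) \<omega>) (u (- s)) * - 1) (at s)"
      "((\<lambda>r. v (- r)) has_real_derivative f (\<sigma> (- s) \<omega>) (v (- s)) * - 1) (at s)"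
      by (rule DERIV_chain2[where g = uminus, OF solves_onD(4)[OF u mem(1)]], simp add: DERIV_minus DERIV_ident)
         (rule DERIV_chain2[where g = uminus, OF solves_onD(4)[OF v mem(2)]], simp add: DERIV_minus DERIV_ident)
    from DERIV_diff[OF this] show "(d has_real_derivative d' s) (at s)"
      by (simp add: d_def[abs_def] d'_def)
    show "((\<lambda>s. L * s) has_real_derivative L) (at s)"
      by (auto intro!: derivative_eq_intros)
    have "d' s * d s \<le> \<bar>d' s\<bar> * \<bar>d s\<bar>"
      by (metis abs_ge_self abs_mult)
    also have "\<dots> \<le> (L * \<bar>d s\<bar>) * \<bar>d s\<bar>"
      using L[OF range, of "\<sigma> (- s) \<omega>"] by (intro mult_right_mono) (auto simp: d_def d'_def)
    finally show "d' s * d s \<le> L * (d s)\<^sup>2"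
      by (simp add: power2_eq_square)
  qed
  then show ?thesis
    by (simp add: d_def solves_onD(1)[OF u] solves_onD(1)[OF v])
qed

lemma max_sol_eq:
  assumes u: "solves_on \<sigma> f \<omega> x0 I u" and t: "t \<in> I"
  shows "max_sol \<sigma> f t \<omega> x0 = u t"
  unfolding max_sol_def
proof (rule the_equality)
  show "\<exists>I v. solves_on \<sigma> f \<omega> x0 I v \<and> t \<in> I \<and> v t = u t"
    using assms by blast
  show "y = u t" if "\<exists>I v. solves_on \<sigma> f \<omega> x0 I v \<and> t \<in> I \<and> v t = y" for y
    using that solution_unique[OF _ u _ t] by blast
qed

text \<open>A solution that starts in \<open>[-M, M]\<close>, where \<open>f\<close> points inwards at \<open>\<plusminus>M\<close> and beyond, stays in
  this interval. The truncation of the state at \<open>\<plusminus>(M + 1)\<close> therefore has no influence on it. The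
  margin \<open>1\<close> covers a short time before \<open>0\<close>, needed because solutions live on open intervals.\<close>

lemma forward_complete:
  assumes "t \<ge> 0"
  shows "t \<in> max_dom \<sigma> f \<omega> x0"
proof -
  obtain R where R: "\<And>\<omega> x. x \<ge> R \<Longrightarrow> f \<omega> x \<le> 0" "\<And>\<omega> x. x \<le> - R \<Longrightarrow> f \<omega> x \<ge> 0"
    using inward by blast
  define M where "M = max \<bar>R\<bar> \<bar>x0\<bar>"
  define cl where "cl x = max (- (M + 1)) (min (M + 1) x)" for x
  have M: "M \<ge> R" "M \<ge> \<bar>x0\<bar>" "M \<ge> 0"
    by (auto simp: M_def)
  have cl_range: "cl x \<in> {- (M + 1)..M + 1}" "\<bar>cl x\<bar> \<le> M + 1" for x
    using M by (auto simp: cl_def)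
  have cl_id: "cl x = x" if "\<bar>x\<bar> \<le> M + 1" for x
    using that by (auto simp: cl_def)
  have cl_lip: "\<bar>cl x - cl y\<bar> \<le> \<bar>x - y\<bar>" for x y
    by (auto simp: cl_def max_def min_def)
  have "compact ((\<lambda>(\<omega>, x). f \<omega> x) ` (UNIV \<times> {- (M + 1)..M + 1}))"
    by (intro compact_continuous_image compact_Times compact_base continuous_on_subset[OF continuous_f])
       auto
  then obtain B where B: "\<And>\<omega> x. x \<in> {- (M + 1)..M + 1} \<Longrightarrow> \<bar>f \<omega> x\<bar> \<le> B"
    using compact_imp_bounded by (fastforce simp: bounded_iff)
  obtain L where L:
    "\<And>\<omega> x y. \<bar>x\<bar> \<le> M + 1 \<Longrightarrow> \<bar>y\<bar> \<le> M + 1 \<Longrightarrow> \<bar>f \<omega> x - f \<omega> y\<bar> \<le> L * \<bar>x - y\<bar>"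
    using lipschitz[of "M + 1"] by blast
  have "continuous_on UNIV ((\<lambda>(\<omega>, x). f \<omega> x) \<circ> (\<lambda>(t, x). (\<sigma> t \<omega>, cl x)))"
    unfolding cl_def case_prod_unfold
    by (intro continuous_on_compose continuous_intros continuous_on_subset[OF continuous_f[unfolded case_prod_unfold]]
        continuous_on_compose2[OF continuous_on_orbit[OF flow]]) auto
  then have cont: "continuous_on UNIV (\<lambda>(t, x). f (\<sigma> t \<omega>) (cl x))"
    by (simp add: o_def case_prod_unfold)
  have lip: "\<bar>f (\<sigma> t \<omega>) (cl x) - f (\<sigma> t \<omega>) (cl y)\<bar> \<le> \<bar>L\<bar> * \<bar>x - y\<bar>" for t x y
  proof -
    have "\<bar>f (\<sigma> t \<omega>) (cl x) - f (\<sigma> t \<omega>) (cl y)\<bar> \<le> L * \<bar>cl x - cl y\<bar>"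
      by (rule L[OF cl_range(2) cl_range(2)])
    also have "\<dots> \<le> \<bar>L\<bar> * \<bar>x - y\<bar>"
      by (intro mult_mono cl_lip) auto
    finally show ?thesis .
  qed
  obtain u where u0: "u 0 = x0"
    and u: "\<And>t. (u has_real_derivative f (\<sigma> t \<omega>) (cl (u t))) (at t)"
    using bounded_lipschitz_ode_global_solution[OF cont B[OF cl_range(1)] lip, of x0] by blast
  have upper: "u s \<le> M" if "s \<ge> 0" for s
    by (rule upper_barrier[OF that u]) (use M R(1) u0 in \<open>auto simp: cl_def\<close>)
  have lower: "- u s \<le> M" if "s \<ge> 0" for s
    by (rule upper_barrier[where u = "\<lambda>s. - u s", OF that DERIV_minus[OF u]])
       (use M R(2) u0 in \<open>auto simp: cl_def\<close>)
  have "isCont u 0"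
    using u DERIV_isCont by blast
  then obtain e where e: "e > 0" "\<And>s. \<bar>s\<bar> < e \<Longrightarrow> \<bar>u s - u 0\<bar> < 1"
    unfolding continuous_at_eps_delta dist_real_def by (metis diff_zero zero_less_one)
  have "\<bar>u s\<bar> \<le> M + 1" if "s > - e" for s
  proof (cases "s \<ge> 0")
    case True
    then show ?thesis
      using upper[OF True] lower[OF True] by (auto simp: abs_le_iff)
  next
    case False
    then show ?thesis
      using e(2)[of s] that M u0 by auto
  qed
  then have "solves_on \<sigma> f \<omega> x0 {- e<..} u"
    unfolding solves_on_def using u0 e(1) u cl_id by (auto simp: is_interval_1) metis
  then show ?thesis
    using assms e(1) by (force simp: max_dom_def)
qed

lemma max_sol_diff_bound:
  assumes "t \<ge> 0"
  shows "\<bar>max_sol \<sigma> f t \<omega> x0 - max_sol \<sigma> f t \<omega> y0\<bar> \<le> \<bar>x0 - y0\<bar> * exp (orbit_integral \<sigma> a \<omega> t)"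
proof -
  obtain I u J v where sols: "solves_on \<sigma> f \<omega> x0 I u" "t \<in> I" "solves_on \<sigma> f \<omega> y0 J v" "t \<in> J"
    using forward_complete[OF assms, of \<omega>] by (auto simp: max_dom_def) blast
  then show ?thesis
    using solution_contraction[OF sols(1,3) assms sols(2,4)] by (simp add: max_sol_eq)
qed

end

lemma tau_invariant_image:
  assumes "tau_invariant \<sigma> f K" "(\<omega>, x) \<in> K"
  shows "(\<sigma> t \<omega>, max_sol \<sigma> f t \<omega> x) \<in> K" and "t \<in> max_dom \<sigma> f \<omega> x"
proof -
  show dom: "t \<in> max_dom \<sigma> f \<omega> x"
    using assms by (auto simp: tau_invariant_def)
  have "(\<sigma> t \<omega>, max_sol \<sigma> f t \<omega> x) \<in> tau_image \<sigma> f t K"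
    using dom assms(2) by (auto simp: tau_image_def)
  then show "(\<sigma> t \<omega>, max_sol \<sigma> f t \<omega> x) \<in> K"
    using assms(1) by (simp add: tau_invariant_def)
qed

lemma tau_invariant_preimage:
  assumes "continuous_flow \<sigma>" "tau_invariant \<sigma> f K" "(\<omega>, x) \<in> K"
  obtains y where "(\<sigma> (- t) \<omega>, y) \<in> K" "x = max_sol \<sigma> f t (\<sigma> (- t) \<omega>) y"
proof -
  have "(\<omega>, x) \<in> tau_image \<sigma> f t K"
    using assms(2,3) by (simp add: tau_invariant_def)
  then obtain \<omega>' y where "(\<omega>', y) \<in> K" "\<omega> = \<sigma> t \<omega>'" "x = max_sol \<sigma> f t \<omega>' y"
    by (auto simp: tau_image_def)
  then show thesis
    using that by (simp add: flow_inverse[OF assms(1)])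
qed

section \<open>Compact invariant sets of an exponentially contracting family\<close>

locale exponentially_contracting_family = dissipative_family \<sigma> f a
  for \<sigma> :: "real \<Rightarrow> 'w::metric_space \<Rightarrow> 'w" and f :: "'w \<Rightarrow> real \<Rightarrow> real" and a :: "'w \<Rightarrow> real" +
  fixes \<kappa> \<gamma> :: real
  assumes \<kappa>: "\<kappa> \<ge> 1" and \<gamma>: "\<gamma> > 0"
    and decay: "forward_decay \<sigma> a \<kappa> \<gamma>"
    and minimal_base: "minimal_set (flow_invariant \<sigma>) (UNIV :: 'w set)"
begin

lemma max_sol_contraction:
  assumes "t \<ge> 0"
  shows "\<bar>max_sol \<sigma> f t \<omega> x - max_sol \<sigma> f t \<omega> y\<bar> \<le> \<kappa> * exp (- \<gamma> * t) * \<bar>x - y\<bar>"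
proof -
  have "\<bar>x - y\<bar> * exp (orbit_integral \<sigma> a \<omega> t) \<le> \<bar>x - y\<bar> * (\<kappa> * exp (- \<gamma> * t))"
    using decay assms by (intro mult_left_mono) (auto simp: forward_decay_def)
  then show ?thesis
    using max_sol_diff_bound[OF assms, of \<omega> x y] by (simp add: mult_ac)
qed

text \<open>Both points are images of points over \<open>\<sigma> (- t) \<omega>\<close> in the respective sets. The latter are at
  a distance bounded independently of \<open>t\<close>, and the flow contracts it by \<open>\<kappa> exp (- \<gamma> t)\<close>.\<close>

lemma invariant_fibres_agree:
  assumes K1: "compact K1" "tau_invariant \<sigma> f K1" "(\<omega>, x) \<in> K1"
    and K2: "compact K2" "tau_invariant \<sigma> f K2" "(\<omega>, y) \<in> K2"
  shows "x = y"
proof -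
  have "bounded (snd ` (K1 \<union> K2))"
    by (intro compact_imp_bounded compact_continuous_image continuous_intros compact_Un K1 K2)
  then obtain D where D: "\<And>p. p \<in> K1 \<union> K2 \<Longrightarrow> \<bar>snd p\<bar> \<le> D"
    by (auto simp: bounded_iff)
  have bound: "\<bar>x - y\<bar> \<le> \<kappa> * exp (- \<gamma> * t) * (2 * D)" if t: "t \<ge> 0" for t
  proof -
    obtain x' where x': "(\<sigma> (- t) \<omega>, x') \<in> K1" "x = max_sol \<sigma> f t (\<sigma> (- t) \<omega>) x'"
      by (rule tau_invariant_preimage[OF flow K1(2,3)])
    obtain y' where y': "(\<sigma> (- t) \<omega>, y') \<in> K2" "y = max_sol \<sigma> f t (\<sigma> (- t) \<omega>) y'"
      by (rule tau_invariant_preimage[OF flow K2(2,3)])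
    have "\<bar>x' - y'\<bar> \<le> 2 * D"
      using D[of "(\<sigma> (- t) \<omega>, x')"] D[of "(\<sigma> (- t) \<omega>, y')"] x' y' by auto
    then have "\<kappa> * exp (- \<gamma> * t) * \<bar>x' - y'\<bar> \<le> \<kappa> * exp (- \<gamma> * t) * (2 * D)"
      using \<kappa> by (intro mult_left_mono) auto
    then show ?thesis
      using max_sol_contraction[OF t, of "\<sigma> (- t) \<omega>" x' y'] x' y' by simp
  qed
  have "((\<lambda>t. exp (- \<gamma> * t)) \<longlongrightarrow> 0) at_top"
    using \<gamma>
    by (intro filterlim_compose[OF exp_at_bot] filterlim_tendsto_neg_mult_at_bot[OF tendsto_const])
       (auto simp: filterlim_ident)
  then have "((\<lambda>t. \<kappa> * exp (- \<gamma> * t) * (2 * D)) \<longlongrightarrow> 0) at_top"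
    by (intro tendsto_mult_left_zero tendsto_mult_right_zero)
  moreover have "eventually (\<lambda>t. \<bar>x - y\<bar> \<le> \<kappa> * exp (- \<gamma> * t) * (2 * D)) at_top"
    by (rule eventually_at_top_linorderI[of 0]) (rule bound)
  ultimately have "\<bar>x - y\<bar> \<le> 0"
    by (rule tendsto_lowerbound) simp
  then show ?thesis
    by simp
qed

lemma invariant_projects_onto_base:
  assumes K: "compact K" "tau_invariant \<sigma> f K" "K \<noteq> {}"
  shows "fst ` K = UNIV"
proof -
  have "\<sigma> t ` fst ` K = fst ` K" for t
  proof
    show "\<sigma> t ` fst ` K \<subseteq> fst ` K"
      using tau_invariant_image(1)[OF K(2)] by force
    show "fst ` K \<subseteq> \<sigma> t ` fst ` K"
    proof
      fix \<omega> assume "\<omega> \<in> fst ` K"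
      then obtain x where "(\<omega>, x) \<in> K" by auto
      then obtain y where "(\<sigma> (- t) \<omega>, y) \<in> K"
        using tau_invariant_preimage[OF flow K(2)] by metis
      moreover have "\<omega> = \<sigma> t (\<sigma> (- t) \<omega>)"
        using flow_inverse[OF flow, of "- t" \<omega>] by simp
      ultimately show "\<omega> \<in> \<sigma> t ` fst ` K"
        by force
    qed
  qed
  then have "flow_invariant \<sigma> (fst ` K)"
    by (simp add: flow_invariant_def)
  moreover have "compact (fst ` K)"
    by (intro compact_continuous_image continuous_intros K)
  ultimately show ?thesis
    using minimal_base K(3) by (auto simp: minimal_set_def)
qed

lemma compact_invariant_unique:
  assumes K: "compact K" "tau_invariant \<sigma> f K" "K \<noteq> {}"
    and N: "compact N" "tau_invariant \<sigma> f N" "N \<noteq> {}"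
  shows "N = K"
proof -
  have "N \<subseteq> K" if K: "compact K" "tau_invariant \<sigma> f K" "K \<noteq> {}"
    and N: "compact N" "tau_invariant \<sigma> f N" for N K
  proof
    fix p assume p: "p \<in> N"
    have "fst p \<in> fst ` K"
      by (simp add: invariant_projects_onto_base[OF K])
    then obtain x where "(fst p, x) \<in> K"
      by auto
    moreover from this have "snd p = x"
      using invariant_fibres_agree[OF N, of "fst p" "snd p" K x] K p by simp
    ultimately show "p \<in> K"
      by (metis prod.collapse)
  qed
  from this[OF K N(1,2)] this[OF N K(1,2)] show ?thesis
    by blast
qed

text \<open>Continuity is the closed graph theorem: the preimage of a closed set is the projection of a
  compact subset of the graph.\<close>

lemma compact_invariant_is_copy_of_base:
  assumes K: "compact K" "tau_invariant \<sigma> f K" "K \<noteq> {}"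
  obtains \<eta> where "K = base_graph \<eta>" "copy_of_base_fun \<sigma> f \<eta>"
proof -
  have "\<exists>x. (\<omega>, x) \<in> K" for \<omega>
  proof -
    have "\<omega> \<in> fst ` K"
      by (simp add: invariant_projects_onto_base[OF K])
    then show ?thesis
      by auto
  qed
  then obtain \<eta> where \<eta>: "\<And>\<omega>. (\<omega>, \<eta> \<omega>) \<in> K"
    by metis
  have \<eta>_unique: "x = \<eta> \<omega>" if "(\<omega>, x) \<in> K" for \<omega> x
    using invariant_fibres_agree[OF K(1,2) that K(1,2) \<eta>] .
  show thesis
  proof
    show "K = base_graph \<eta>"
      using \<eta> \<eta>_unique by (auto simp: base_graph_def)
    have "closed (\<eta> -` C)" if C: "closed C" for C
    proof -
      have "\<eta> -` C = fst ` (K \<inter> UNIV \<times> C)"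
        using \<eta> \<eta>_unique by force
      moreover have "compact (fst ` (K \<inter> UNIV \<times> C))"
        by (intro compact_continuous_image continuous_intros compact_Int_closed closed_Times K C)
      ultimately show ?thesis
        by (simp add: compact_imp_closed)
    qed
    then have "continuous_on UNIV \<eta>"
      by (simp add: continuous_on_closed_vimage)
    moreover have "\<eta> (\<sigma> t \<omega>) = max_sol \<sigma> f t \<omega> (\<eta> \<omega>)" for t \<omega>
      using \<eta>_unique[OF tau_invariant_image(1)[OF K(2) \<eta>]] by simp
    ultimately show "copy_of_base_fun \<sigma> f \<eta>"
      using tau_invariant_image(2)[OF K(2) \<eta>] by (simp add: copy_of_base_fun_def)
  qed
qed

lemma compact_invariant_uniformly_exp_stable:
  assumes "compact K" "tau_invariant \<sigma> f K"
  shows "uniformly_exp_stable \<sigma> f K"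
  unfolding uniformly_exp_stable_def
proof (intro conjI assms)
  show "\<exists>\<delta>>0. \<exists>\<kappa>\<ge>1. \<exists>\<gamma>>0. \<forall>\<omega> y0 x0. (\<omega>, y0) \<in> K \<and> \<bar>y0 - x0\<bar> < \<delta> \<longrightarrow>
      (\<forall>t\<ge>0. t \<in> max_dom \<sigma> f \<omega> x0 \<and>
        \<bar>max_sol \<sigma> f t \<omega> y0 - max_sol \<sigma> f t \<omega> x0\<bar> \<le> \<kappa> * exp (- \<gamma> * t) * \<bar>y0 - x0\<bar>)"
    using \<kappa> \<gamma> forward_complete max_sol_contraction
    by (intro exI[of _ 1] exI[of _ \<kappa>] exI[of _ \<gamma>] conjI) auto
qed

lemma copy_of_base_attracts_exponentially:
  assumes "copy_of_base_fun \<sigma> f \<eta>"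
  shows "attracts_exponentially \<sigma> f \<eta>"
  unfolding attracts_exponentially_def
proof (intro allI)
  fix \<omega> x0
  \<comment> \<open>The summand \<open>1\<close> keeps the constant positive when the orbit starts on the graph.\<close>
  define C where "C = \<kappa> * (\<bar>x0 - \<eta> \<omega>\<bar> + 1)"
  have "C > 0"
    using \<kappa> by (simp add: C_def)
  moreover have "\<bar>max_sol \<sigma> f t \<omega> x0 - \<eta> (\<sigma> t \<omega>)\<bar> \<le> C * exp (- \<gamma> * t)" if t: "t \<ge> 0" for t
  proof -
    have "\<bar>max_sol \<sigma> f t \<omega> x0 - \<eta> (\<sigma> t \<omega>)\<bar> \<le> \<kappa> * exp (- \<gamma> * t) * \<bar>x0 - \<eta> \<omega>\<bar>"
      using max_sol_contraction[OF t] assms by (simp add: copy_of_base_fun_def)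
    also have "\<dots> \<le> \<kappa> * exp (- \<gamma> * t) * (\<bar>x0 - \<eta> \<omega>\<bar> + 1)"
      using \<kappa> by (intro mult_left_mono) auto
    finally show ?thesis
      by (simp add: C_def mult_ac)
  qed
  ultimately show "\<exists>C>0. \<exists>\<gamma>>0. \<forall>t\<ge>0. t \<in> max_dom \<sigma> f \<omega> x0 \<and>
      \<bar>max_sol \<sigma> f t \<omega> x0 - \<eta> (\<sigma> t \<omega>)\<bar> \<le> C * exp (- \<gamma> * t)"
    using \<gamma> forward_complete by blast
qed

text \<open>The empty set attracts nothing, because the forward orbit of a point never becomes empty.\<close>

lemma global_attractor_nonempty:
  assumes "global_attractor \<sigma> f A"
  shows "A \<noteq> {}"
proof
  assume "A = {}"
  fix \<omega> :: 'w
  have "bounded {(\<omega>, 0 :: real)}"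
    by simp
  then have "((\<lambda>t. hausdorff_semidist (tau_image \<sigma> f t {(\<omega>, 0)}) A) \<longlongrightarrow> 0) at_top"
    using assms unfolding global_attractor_def by blast
  then have "eventually (\<lambda>t. hausdorff_semidist (tau_image \<sigma> f t {(\<omega>, 0)}) A < 1) at_top"
    by (rule order_tendstoD) simp
  then obtain T where T: "\<And>t. t \<ge> T \<Longrightarrow> hausdorff_semidist (tau_image \<sigma> f t {(\<omega>, 0)}) A < 1"
    by (auto simp: eventually_at_top_linorder)
  have "tau_image \<sigma> f (max T 0) {(\<omega>, 0)} \<noteq> {}"
    using forward_complete[of "max T 0" \<omega> 0] by (auto simp: tau_image_def)
  then have "hausdorff_semidist (tau_image \<sigma> f (max T 0) {(\<omega>, 0)}) A = top"
    using \<open>A = {}\<close> by (simp add: hausdorff_semidist_def)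
  then show False
    using T[of "max T 0"] by simp
qed

end

section \<open>The dissipative family with a linear part\<close>

text \<open>On each side of \<open>[r1, r2]\<close> this is the mean value theorem; points that are separated by, or
  belong to, the interval are compared through the sign of \<open>g\<close>.\<close>

lemma antimono_of_sign_and_derivative:
  fixes g gx :: "real \<Rightarrow> real"
  assumes der: "\<And>x. (g has_real_derivative gx x) (at x)"
    and mid: "\<And>x. r1 \<le> x \<Longrightarrow> x \<le> r2 \<Longrightarrow> g x = 0"
    and left: "\<And>x. x < r1 \<Longrightarrow> g x > 0"
    and right: "\<And>x. x > r2 \<Longrightarrow> g x < 0"
    and gx: "\<And>x. x \<notin> {r1..r2} \<Longrightarrow> gx x \<le> 0"
    and xy: "x \<le> y"
  shows "g y \<le> g x"
proof -
  consider "y < r1" | "x > r2" | "x \<le> r2" "r1 \<le> y"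
    by linarith
  then show ?thesis
  proof cases
    case 1
    then show ?thesis
      by (intro DERIV_nonpos_imp_nonincreasing[OF xy]) (use der gx in force)
  next
    case 2
    then show ?thesis
      by (intro DERIV_nonpos_imp_nonincreasing[OF xy]) (use der gx in force)
  next
    case 3
    have "g x \<ge> 0"
      using mid[of x] left[of x] 3 by (cases "x < r1") auto
    moreover have "g y \<le> 0"
      using mid[of y] right[of y] 3 by (cases "y > r2") auto
    ultimately show ?thesis
      by simp
  qed
qed

text \<open>Monotonicity of \<open>g\<close> turns the coefficient \<open>a\<close> of the linear part into the one-sided bound, and
  the superlinear decay of \<open>g\<close> dominates \<open>a x + b\<close> for large \<open>\<bar>x\<bar>\<close>.\<close>

lemma family_rhs_dissipative:
  fixes \<sigma> :: "real \<Rightarrow> 'w::metric_space \<Rightarrow> 'w"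
    and a b :: "'w \<Rightarrow> real"
    and g gx :: "'w \<Rightarrow> real \<Rightarrow> real"
  assumes comp: "compact (UNIV :: 'w set)"
    and flow: "continuous_flow \<sigma>"
    and conta: "continuous_on UNIV a"
    and contb: "continuous_on UNIV b"
    and der: "\<And>\<omega> x. (g \<omega> has_real_derivative gx \<omega> x) (at x)"
    and contg: "continuous_on UNIV (\<lambda>(\<omega>, x). g \<omega> x)"
    and contgx: "continuous_on UNIV (\<lambda>(\<omega>, x). gx \<omega> x)"
    and antimono: "\<And>\<omega> x y. x \<le> y \<Longrightarrow> g \<omega> y \<le> g \<omega> x"
    and top: "\<And>L. eventually (\<lambda>x. \<forall>\<omega>. g \<omega> x / x \<le> L) at_top"
    and bot: "\<And>L. eventually (\<lambda>x. \<forall>\<omega>. g \<omega> x / x \<le> L) at_bot"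
  shows "dissipative_family \<sigma> (family_rhs a b g) a"
proof
  obtain \<alpha> where \<alpha>: "\<And>\<omega>. \<bar>a \<omega>\<bar> \<le> \<alpha>"
    using compact_imp_bounded[OF compact_continuous_image[OF conta comp]]
    by (auto simp: bounded_iff)
  obtain \<beta> where \<beta>: "\<And>\<omega>. \<bar>b \<omega>\<bar> \<le> \<beta>"
    using compact_imp_bounded[OF compact_continuous_image[OF contb comp]]
    by (auto simp: bounded_iff)
  have \<beta>0: "\<beta> \<ge> 0"
    using \<beta>[of undefined] by linarith
  show "continuous_on UNIV (\<lambda>(\<omega>, x). family_rhs a b g \<omega> x)"
    using contg unfolding family_rhs_def case_prod_unfold
    by (intro continuous_intros continuous_on_compose2[OF conta] continuous_on_compose2[OF contb])
       auto
  show "\<exists>L. \<forall>\<omega> x y. \<bar>x\<bar> \<le> R \<longrightarrow> \<bar>y\<bar> \<le> R \<longrightarrow>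
      \<bar>family_rhs a b g \<omega> x - family_rhs a b g \<omega> y\<bar> \<le> L * \<bar>x - y\<bar>" for R
  proof -
    have "compact ((\<lambda>(\<omega>, x). gx \<omega> x) ` (UNIV \<times> {- R..R}))"
      by (intro compact_continuous_image compact_Times comp continuous_on_subset[OF contgx]) auto
    then obtain G where G: "\<And>\<omega> x. x \<in> {- R..R} \<Longrightarrow> \<bar>gx \<omega> x\<bar> \<le> G"
      using compact_imp_bounded by (fastforce simp: bounded_iff)
    have "\<bar>family_rhs a b g \<omega> x - family_rhs a b g \<omega> y\<bar> \<le> (\<alpha> + G) * \<bar>x - y\<bar>"
      if xy: "\<bar>x\<bar> \<le> R" "\<bar>y\<bar> \<le> R" for \<omega> x y
    proof -
      have "norm (family_rhs a b g \<omega> x - family_rhs a b g \<omega> y) \<le> (\<alpha> + G) * norm (x - y)"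
      proof (rule field_differentiable_bound[of "{- R..R}"])
        fix z assume z: "z \<in> {- R..R}"
        show "(family_rhs a b g \<omega> has_field_derivative a \<omega> + gx \<omega> z) (at z within {- R..R})"
          unfolding family_rhs_def[abs_def]
          by (rule has_field_derivative_at_within) (auto intro!: derivative_eq_intros der)
        show "norm (a \<omega> + gx \<omega> z) \<le> \<alpha> + G"
          using \<alpha>[of \<omega>] G[OF z, of \<omega>] by simp
      qed (use xy in auto)
      then show ?thesis
        by simp
    qed
    then show ?thesis
      by blast
  qed
  show "(family_rhs a b g \<omega> x - family_rhs a b g \<omega> y) * (x - y) \<le> a \<omega> * (x - y)\<^sup>2" for \<omega> x y
  proof -
    have "(g \<omega> x - g \<omega> y) * (x - y) \<le> 0"
      using antimono[of x y \<omega>] antimono[of y x \<omega>] by (cases "x \<le> y") (auto simp: mult_le_0_iff)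
    then show ?thesis
      by (simp add: family_rhs_def power2_eq_square algebra_simps)
  qed
  \<comment> \<open>Where \<open>g / x\<close> is below this constant and \<open>\<bar>x\<bar> \<ge> 1\<close>, it outweighs \<open>a + b / x\<close>.\<close>
  let ?L = "- (\<alpha> + \<beta>)"
  obtain R1 where R1: "\<And>\<omega> x. x \<ge> R1 \<Longrightarrow> g \<omega> x / x \<le> ?L"
    using top[of ?L] by (auto simp: eventually_at_top_linorder)
  obtain R2 where R2: "\<And>\<omega> x. x \<le> R2 \<Longrightarrow> g \<omega> x / x \<le> ?L"
    using bot[of ?L] by (auto simp: eventually_at_bot_linorder)
  have quotient: "family_rhs a b g \<omega> x / x \<le> 0" if x: "\<bar>x\<bar> \<ge> 1" and gx: "g \<omega> x / x \<le> ?L" for \<omega> x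
  proof -
    have "\<bar>b \<omega> / x\<bar> \<le> \<beta>"
      using \<beta>[of \<omega>] \<beta>0 x mult_left_mono[OF x \<beta>0] by (auto simp: abs_divide pos_divide_le_eq)
    moreover have "family_rhs a b g \<omega> x / x = a \<omega> + b \<omega> / x + g \<omega> x / x"
      using x by (auto simp: family_rhs_def add_divide_distrib)
    ultimately show ?thesis
      using gx \<alpha>[of \<omega>] by linarith
  qed
  show "\<exists>R. \<forall>\<omega> x. (x \<ge> R \<longrightarrow> family_rhs a b g \<omega> x \<le> 0) \<and> (x \<le> - R \<longrightarrow> family_rhs a b g \<omega> x \<ge> 0)"
  proof (intro exI allI conjI impI)
    let ?R = "max 1 (max R1 (- R2))"
    fix \<omega> x
    show "family_rhs a b g \<omega> x \<le> 0" if "x \<ge> ?R"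
      using quotient[of x \<omega>] R1[of x \<omega>] that by (auto simp: divide_le_0_iff)
    show "family_rhs a b g \<omega> x \<ge> 0" if "x \<le> - ?R"
      using quotient[of x \<omega>] R2[of x \<omega>] that by (auto simp: divide_le_0_iff)
  qed
qed (use comp flow conta in auto)

theorem theorem3p6:
  fixes \<sigma> :: "real \<Rightarrow> 'w::metric_space \<Rightarrow> 'w"
    and a b :: "'w \<Rightarrow> real"
    and g gx :: "'w \<Rightarrow> real \<Rightarrow> real"
    and r1 r2 :: real
    and A :: "('w \<times> real) set"
  assumes "compact (UNIV :: 'w set)"
    and "continuous_flow \<sigma>"
    and "minimal_set (flow_invariant \<sigma>) (UNIV :: 'w set)"
    and "continuous_on UNIV a"
    and "continuous_on UNIV b"
    and "\<And>\<omega> x. (g \<omega> has_real_derivative gx \<omega> x) (at x)"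
    and "continuous_on UNIV (\<lambda>(\<omega>, x). g \<omega> x)"
    and "continuous_on UNIV (\<lambda>(\<omega>, x). gx \<omega> x)"
    and "r1 \<le> r2"
    and "\<And>\<omega> x. r1 \<le> x \<Longrightarrow> x \<le> r2 \<Longrightarrow> g \<omega> x = 0"
    and "\<And>\<omega> x. x < r1 \<Longrightarrow> g \<omega> x > 0"
    and "\<And>\<omega> x. x > r2 \<Longrightarrow> g \<omega> x < 0"
    and "\<And>\<omega>. r1 = r2 \<Longrightarrow> gx \<omega> r1 = 0"
    and "\<And>L. eventually (\<lambda>x. \<forall>\<omega>. g \<omega> x / x \<le> L) at_top"
    and "\<And>L. eventually (\<lambda>x. \<forall>\<omega>. g \<omega> x / x \<le> L) at_bot"
    and "\<And>\<omega> x. x \<notin> {r1..r2} \<Longrightarrow> gx \<omega> x \<le> 0"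
    and "global_attractor \<sigma> (family_rhs a b g) A"
    and "Sup (sacker_sell_spectrum \<sigma> a) < 0"
  shows "uniformly_exp_stable \<sigma> (family_rhs a b g) A \<and>
    (\<exists>\<eta>. A = base_graph \<eta> \<and> copy_of_base_fun \<sigma> (family_rhs a b g) \<eta> \<and>
       attracts_exponentially \<sigma> (family_rhs a b g) \<eta>) \<and>
    minimal_set (tau_invariant \<sigma> (family_rhs a b g)) A \<and>
    (\<forall>M. minimal_set (tau_invariant \<sigma> (family_rhs a b g)) M \<longrightarrow> M = A)"
proof -
  let ?f = "family_rhs a b g"
  have antimono: "g \<omega> y \<le> g \<omega> x" if "x \<le> y" for \<omega> x y
    by (rule antimono_of_sign_and_derivative[OF assms(6,10,11,12,16) that])
  obtain \<kappa> \<gamma> where decay: "\<kappa> \<ge> 1" "\<gamma> > 0" "forward_decay \<sigma> a \<kappa> \<gamma>"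
    by (rule spectrum_negative_imp_forward_decay[OF assms(1,2,4,18)])
  interpret dissipative_family \<sigma> ?f a
    by (rule family_rhs_dissipative[OF assms(1,2,4,5,6,7,8) antimono assms(14,15)])
  interpret exponentially_contracting_family \<sigma> ?f a \<kappa> \<gamma>
    by unfold_locales (use decay assms(3) in auto)
  have A: "compact A" "tau_invariant \<sigma> ?f A"
    using assms(17) by (auto simp: global_attractor_def)
  have A_ne: "A \<noteq> {}"
    by (rule global_attractor_nonempty[OF assms(17)])
  obtain \<eta> where "A = base_graph \<eta>" "copy_of_base_fun \<sigma> ?f \<eta>"
    by (rule compact_invariant_is_copy_of_base[OF A A_ne])
  moreover from this(2) have "attracts_exponentially \<sigma> ?f \<eta>"
    by (rule copy_of_base_attracts_exponentially)
  moreover have "minimal_set (tau_invariant \<sigma> ?f) A"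
    unfolding minimal_set_def using A A_ne compact_invariant_unique[OF A A_ne] by blast
  moreover have "M = A" if "minimal_set (tau_invariant \<sigma> ?f) M" for M
    using that compact_invariant_unique[OF A A_ne] unfolding minimal_set_def by blast
  ultimately show ?thesis
    using compact_invariant_uniformly_exp_stable[OF A] by blast
qed

end
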